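(* Let $1\le i\le m+n-1$ with $\bar v_i+\bar v_{i+1}=\bar1$. Let $X(T)_1$ denote $X(T)$ with the crystal structure $(\tilde e_r^*,\tilde f_r^*,\varepsilon_r^*,\varphi_r^*,\mathrm{wt})$ associated to the parity sequence $(\bar v_1,\dots,\bar v_i,\bar v_{i+1},\dots,\bar v_{m+n})$, and let $X(T)_2$ denote $X(T)$ with the crystal structure associated to the parity sequence $(\bar v_1,\dots,\bar v_{i+1},\bar v_i,\dots,\bar v_{m+n})$ obtained by interchanging the $i$-th and $(i+1)$-st entries. Then the map $$s_i:X(T)_1\to X(T)_2,\qquad s_i(\lambda)=\begin{cases}(i\ i{+}1)\cdot\lambda,&\text{if }(\lambda,\varepsilon_i-\varepsilon_{i+1})\equiv0\pmod p,\\ (i\ i{+}1)\cdot\lambda-\varepsilon_{i+1}+\varepsilon_i,&\text{if }(\lambda,\varepsilon_i-\varepsilon_{i+1})\not\equiv0\pmod p,\end{cases}$$ is an isomorphism of crystals.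
   Context: $p$ is the characteristic of a field: $p=0$ or $p$ a prime. If $p=0$, then $\mathbb Z/p\mathbb Z=\mathbb Z$ and congruence mod $p$ means equality. $(\bar v_1,\dots,\bar v_{m+n})$ is a sequence in $\mathbb Z_2$ with $m$ entries $\bar0$ and $n$ entries $\bar1$. $X(T)=\bigoplus_{j=1}^{m+n}\mathbb Z\varepsilon_j$, with $S_{m+n}$ acting by $x\cdot\varepsilon_j=\varepsilon_{xj}$. In the definition of $s_i$, $(-,-)$ is the symmetric bilinear form of the sequence $(\bar v_1,\dots,\bar v_{m+n})$. **Crystal structure on $X(T)$ associated to a parity sequence** $(\bar w_1,\dots,\bar w_{m+n})$. Put the symmetric bilinear form $(\varepsilon_a,\varepsilon_b)=(-1)^{\bar w_a}\delta_{a,b}$ on $X(T)$. Let $\vartheta_j=\sum_{a=j+1}^{m+n}(-1)^{\bar w_a+\bar w_j}$, $\vartheta=\sum_j\vartheta_j\varepsilon_j$, $\rho=\vartheta+\sum_{a:\bar w_a=\bar0}\varepsilon_a$. The $j$-residue of $\lambda$ is $r_j(\lambda)=(\lambda+\vartheta,\varepsilon_j)$. For $r\in\mathbb Z/p\mathbb Z$ the $r$-signature of $\lambda$ is $(\sigma_1,\dots,\sigma_{m+n})$, with $\sigma_j=+$ if $r_j(\lambda+\varepsilon_j)\equiv r$ mod $p$, $\sigma_j=-$ if $r_j(\lambda)\equiv r$ mod $p$, and $\sigma_j=0$ otherwise. The reduced $r$-signature is obtained by successively replacing pairs $-,+$ ($-$ to the left of $+$, with only zeros between them) by $0,0$ until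 no $-$ appears to the left of a $+$. $\varepsilon_r^*(\lambda)$ (resp. $\varphi_r^*(\lambda)$) is the number of $-$'s (resp. $+$'s) in the reduced $r$-signature. $\tilde e_r^*(\lambda)=\lambda-\varepsilon_j$ where $j$ is the position of the leftmost $-$ in the reduced $r$-signature, and $\tilde e_r^*(\lambda)=0$ (a formal extra element) if there is no $-$. $\tilde f_r^*(\lambda)=\lambda+\varepsilon_j$ where $j$ is the position of the rightmost $+$, and $\tilde f_r^*(\lambda)=0$ if there is no $+$. If $p=0$, let $P$ be the free abelian group on $\gamma_a$ ($a\in\mathbb Z$). If $p>0$, let $P=\mathbb Z\delta\oplus\bigoplus_{r\in\mathbb Z/p\mathbb Z}\mathbb Z\Lambda_r$ and for $a=pd+s$ with $d\in\mathbb Z$, $s\in\{1,\dots,p\}$, let $\gamma_a=\Lambda_s-\Lambda_{s-1}-d\delta$. Then $\mathrm{wt}(\lambda)=\sum_j(-1)^{\bar w_j}\gamma_{(\lambda+\rho,\varepsilon_j)}\in P$. An isomorphism of crystals is a bijection which preserves $\mathrm{wt},\varepsilon_r^*,\varphi_r^*$ and commutes with $\tilde e_r^*$ and $\tilde f_r^*$ for all $r\in\mathbb Z/p\mathbb Z$ (with $0\mapsto0$). *)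

theory Defs
  imports
    Main
    "HOL-Library.Poly_Mapping"
    "HOL-Library.Z2"
    "HOL-Library.Confluence"
    "HOL-Combinatorics.Transposition"
    "HOL-Number_Theory.Cong"
    "HOL-Computational_Algebra.Primes"
begin

text \<open>
  Conventions. Parity sequences are functions \<open>w :: nat \<Rightarrow> bit\<close> of which only the values at
  \<open>1, \<dots>, N\<close> matter. The free abelian group on a set is the group of finitely supported integral
  functions on it; the basis element \<open>\<epsilon>\<^sub>j\<close> is \<^term>\<open>frag_of j\<close>. An element of \<open>\<int>/p\<int>\<close> is
  given by an integer representative, on which everything below depends only through its
  class mod \<open>p\<close>. Since \<open>[a = b] (mod 0)\<close> is \<open>a = b\<close>, this covers \<open>p = 0\<close> as well.
\<close>

definition weights :: "nat \<Rightarrow> (nat \<Rightarrow>\<^sub>0 int) set" where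
  "weights N = {l. Poly_Mapping.keys l \<subseteq> {1..N}}"

definition perm_act :: "(nat \<Rightarrow> nat) \<Rightarrow> (nat \<Rightarrow>\<^sub>0 int) \<Rightarrow> (nat \<Rightarrow>\<^sub>0 int)" where
  "perm_act x = frag_extend (\<lambda>j. frag_of (x j))"

definition parity_sign :: "bit \<Rightarrow> int" where
  "parity_sign b = (if b = 0 then 1 else - 1)"

definition bform :: "(nat \<Rightarrow> bit) \<Rightarrow> nat \<Rightarrow> (nat \<Rightarrow>\<^sub>0 int) \<Rightarrow> (nat \<Rightarrow>\<^sub>0 int) \<Rightarrow> int" where
  "bform w N l m =
    (\<Sum>a = 1..N. parity_sign (w a) * Poly_Mapping.lookup l a * Poly_Mapping.lookup m a)"

definition vartheta_coeff :: "(nat \<Rightarrow> bit) \<Rightarrow> nat \<Rightarrow> nat \<Rightarrow> int" where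
  "vartheta_coeff w N j = (\<Sum>a = j + 1..N. parity_sign (w a + w j))"

definition vartheta :: "(nat \<Rightarrow> bit) \<Rightarrow> nat \<Rightarrow> (nat \<Rightarrow>\<^sub>0 int)" where
  "vartheta w N = (\<Sum>j = 1..N. frag_cmul (vartheta_coeff w N j) (frag_of j))"

definition rho :: "(nat \<Rightarrow> bit) \<Rightarrow> nat \<Rightarrow> (nat \<Rightarrow>\<^sub>0 int)" where
  "rho w N = vartheta w N + (\<Sum>a \<in> {a \<in> {1..N}. w a = 0}. frag_of a)"

definition residue :: "(nat \<Rightarrow> bit) \<Rightarrow> nat \<Rightarrow> nat \<Rightarrow> (nat \<Rightarrow>\<^sub>0 int) \<Rightarrow> int" where
  "residue w N j l = bform w N (l + vartheta w N) (frag_of j)"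


subsection \<open>Signatures\<close>

datatype sign = Plus | Minus | Zero

text \<open>
  The first two conditions exclude each other, because the two residues differ by \<open>\<plusminus>1\<close>
  and \<open>p \<noteq> 1\<close>. Positions outside \<open>1, \<dots>, N\<close> are padded with \<^const>\<open>Zero\<close>.
\<close>
definition signature ::
    "nat \<Rightarrow> (nat \<Rightarrow> bit) \<Rightarrow> nat \<Rightarrow> int \<Rightarrow> (nat \<Rightarrow>\<^sub>0 int) \<Rightarrow> nat \<Rightarrow> sign" where
  "signature p w N r l j =
    (if j \<notin> {1..N} then Zero
     else if [residue w N j (l + frag_of j) = r] (mod int p) then Plus
     else if [residue w N j l = r] (mod int p) then Minus
     else Zero)"

inductive cancel :: "(nat \<Rightarrow> sign) \<Rightarrow> (nat \<Rightarrow> sign) \<Rightarrow> bool" where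
  "j < k \<Longrightarrow> s j = Minus \<Longrightarrow> s k = Plus \<Longrightarrow> \<forall>i \<in> {j<..<k}. s i = Zero \<Longrightarrow>
    cancel s (s(j := Zero, k := Zero))"

definition is_reduction :: "(nat \<Rightarrow> sign) \<Rightarrow> (nat \<Rightarrow> sign) \<Rightarrow> bool" where
  "is_reduction s t \<longleftrightarrow>
    cancel\<^sup>*\<^sup>* s t \<and> \<not> (\<exists>j k. j < k \<and> t j = Minus \<and> t k = Plus)"

text \<open>Well defined for signatures, by \<open>ex1_is_reduction\<close> below.\<close>
definition reduce :: "(nat \<Rightarrow> sign) \<Rightarrow> (nat \<Rightarrow> sign)" where
  "reduce s = (THE t. is_reduction s t)"

lemma cancel_possible:
  assumes "j < k" "s j = Minus" "s k = Plus"
  shows "\<exists>t. cancel s t"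
  using assms
proof (induction "k - j" arbitrary: j k rule: less_induct)
  case less
  show ?case
  proof (cases "\<forall>i \<in> {j<..<k}. s i = Zero")
    case True
    then show ?thesis using less.prems cancel.intros by blast
  next
    case False
    then obtain i where i: "j < i" "i < k" "s i \<noteq> Zero" by auto
    show ?thesis
    proof (cases "s i")
      case Plus
      show ?thesis by (rule less.hyps[of i j]) (use i Plus less.prems in auto)
    next
      case Minus
      show ?thesis by (rule less.hyps[of k i]) (use i Minus less.prems in auto)
    qed (use i in simp)
  qed
qed

lemma strong_confluentp_cancel: "strong_confluentp cancel"
proof
  fix s t u assume "cancel s t" "cancel s u"
  then obtain j k j' k' where
    t: "t = s(j := Zero, k := Zero)" "j < k" "s j = Minus" "s k = Plus"
      "\<forall>i \<in> {j<..<k}. s i = Zero" and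
    u: "u = s(j' := Zero, k' := Zero)" "j' < k'" "s j' = Minus" "s k' = Plus"
      "\<forall>i \<in> {j'<..<k'}. s i = Zero"
    by (auto elim!: cancel.cases)
  have nz: "i \<notin> {j<..<k} \<and> i \<notin> {j'<..<k'}" if "s i \<noteq> Zero" for i
    using t(5) u(5) that by blast
  have *: "j \<notin> {j'<..<k'}" "k \<notin> {j'<..<k'}" "j' \<notin> {j<..<k}" "k' \<notin> {j<..<k}"
    using t u nz[of j] nz[of k] nz[of j'] nz[of k'] by auto
  have ne: "j \<noteq> k'" "j' \<noteq> k" using t u by auto
  show "\<exists>x. cancel\<^sup>*\<^sup>* t x \<and> cancel\<^sup>=\<^sup>= u x"
  proof (cases "j = j'")
    case True
    then have "k = k'" using * t(2) u(2) by auto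
    with True show ?thesis using t(1) u(1) by auto
  next
    case False
    then have d: "k < j' \<or> k' < j" using * ne t(2) u(2) by auto
    let ?x = "s(j := Zero, k := Zero, j' := Zero, k' := Zero)"
    have "cancel t (t(j' := Zero, k' := Zero))"
      using t u d by (intro cancel.intros) auto
    then have "cancel t ?x" using t(1) by simp
    moreover have "cancel u (u(j := Zero, k := Zero))"
      using t u d by (intro cancel.intros) auto
    moreover have "u(j := Zero, k := Zero) = ?x"
      using u(1) d t(2) u(2) by (auto simp: fun_eq_iff)
    ultimately show ?thesis by auto
  qed
qed

lemma ex1_is_reduction:
  assumes "finite {j. s j \<noteq> Zero}"
  shows "\<exists>!t. is_reduction s t"
proof (rule ex_ex1I)
  show "\<exists>t. is_reduction s t"
    using assms
  proof (induction "card {j. s j \<noteq> Zero}" arbitrary: s rule: less_induct)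
    case less
    show ?case
    proof (cases "\<exists>t. cancel s t")
      case True
      then obtain t where t: "cancel s t" by blast
      then obtain j k where jk: "t = s(j := Zero, k := Zero)" "s j = Minus"
        by (cases rule: cancel.cases)
      have "{j. t j \<noteq> Zero} \<subseteq> {j. s j \<noteq> Zero}"
        unfolding jk(1) by auto
      moreover have "j \<in> {j. s j \<noteq> Zero}" "j \<notin> {j. t j \<noteq> Zero}"
        using jk by auto
      ultimately have sub: "{j. t j \<noteq> Zero} \<subset> {j. s j \<noteq> Zero}" by blast
      have "\<exists>u. is_reduction t u"
      proof (rule less.hyps)
        show "card {j. t j \<noteq> Zero} < card {j. s j \<noteq> Zero}"
          by (rule psubset_card_mono[OF less.prems sub])
        show "finite {j. t j \<noteq> Zero}"
          by (rule finite_subset[OF psubset_imp_subset[OF sub] less.prems])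
      qed
      then obtain u where "is_reduction t u" by blast
      with t show ?thesis
        unfolding is_reduction_def by (meson converse_rtranclp_into_rtranclp)
    next
      case False
      then have "\<not> (\<exists>j k. j < k \<and> s j = Minus \<and> s k = Plus)"
        using cancel_possible by blast
      then have "is_reduction s s" unfolding is_reduction_def by simp
      then show ?thesis by blast
    qed
  qed
next
  fix t u assume tu: "is_reduction s t" "is_reduction s u"
  have stuck: "\<not> cancel y x" if "is_reduction s y" for x y
  proof
    assume "cancel y x"
    then obtain j k where "j < k" "y j = Minus" "y k = Plus" by (cases rule: cancel.cases)
    with that show False unfolding is_reduction_def by blast
  qed
  have "cancel\<^sup>*\<^sup>* s t" "cancel\<^sup>*\<^sup>* s u"
    using tu unfolding is_reduction_def by auto
  then obtain x where x: "cancel\<^sup>*\<^sup>* t x" "cancel\<^sup>*\<^sup>* u x"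
    using confluentpD[OF strong_confluentp_imp_confluentp[OF strong_confluentp_cancel]] by blast
  have "t = x" using x(1) stuck[OF tu(1)] by (cases rule: converse_rtranclpE) auto
  moreover have "u = x" using x(2) stuck[OF tu(2)] by (cases rule: converse_rtranclpE) auto
  ultimately show "t = u" by simp
qed

lemma ex1_is_reduction_signature: "\<exists>!t. is_reduction (signature p w N r l) t"
proof (rule ex1_is_reduction)
  have "{j. signature p w N r l j \<noteq> Zero} \<subseteq> {1..N}"
    by (auto simp: signature_def)
  then show "finite {j. signature p w N r l j \<noteq> Zero}"
    using finite_subset by blast
qed

definition reduced_signature ::
    "nat \<Rightarrow> (nat \<Rightarrow> bit) \<Rightarrow> nat \<Rightarrow> int \<Rightarrow> (nat \<Rightarrow>\<^sub>0 int) \<Rightarrow> nat \<Rightarrow> sign" where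
  "reduced_signature p w N r l = reduce (signature p w N r l)"

definition minus_positions ::
    "nat \<Rightarrow> (nat \<Rightarrow> bit) \<Rightarrow> nat \<Rightarrow> int \<Rightarrow> (nat \<Rightarrow>\<^sub>0 int) \<Rightarrow> nat set" where
  "minus_positions p w N r l = {j \<in> {1..N}. reduced_signature p w N r l j = Minus}"

definition plus_positions ::
    "nat \<Rightarrow> (nat \<Rightarrow> bit) \<Rightarrow> nat \<Rightarrow> int \<Rightarrow> (nat \<Rightarrow>\<^sub>0 int) \<Rightarrow> nat set" where
  "plus_positions p w N r l = {j \<in> {1..N}. reduced_signature p w N r l j = Plus}"


subsection \<open>Crystals\<close>

text \<open>
  \<open>'x\<close> is the type of elements, \<open>'r\<close> that of residues, \<open>'q\<close> that of weights.
  The formal extra element \<open>0\<close> is \<^const>\<open>None\<close>.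
\<close>
record ('x, 'r, 'q) crystal =
  elems :: "'x set"
  wt_of :: "'x \<Rightarrow> 'q"
  eps_of :: "'r \<Rightarrow> 'x \<Rightarrow> nat"
  phi_of :: "'r \<Rightarrow> 'x \<Rightarrow> nat"
  e_op :: "'r \<Rightarrow> 'x \<Rightarrow> 'x option"
  f_op :: "'r \<Rightarrow> 'x \<Rightarrow> 'x option"

definition crystal_iso ::
    "('x, 'r, 'q) crystal \<Rightarrow> ('y, 'r, 'q) crystal \<Rightarrow> ('x \<Rightarrow> 'y) \<Rightarrow> bool" where
  "crystal_iso A B g \<longleftrightarrow>
    bij_betw g (elems A) (elems B) \<and>
    (\<forall>x \<in> elems A.
      wt_of B (g x) = wt_of A x \<and>
      (\<forall>r. eps_of B r (g x) = eps_of A r x \<and>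
           phi_of B r (g x) = phi_of A r x \<and>
           e_op B r (g x) = map_option g (e_op A r x) \<and>
           f_op B r (g x) = map_option g (f_op A r x)))"

text \<open>
  One set of generators serves for both shapes of the weight lattice \<open>P\<close>: for \<open>p = 0\<close> it is
  the span of the \<^term>\<open>Gamma a\<close>, for \<open>p > 0\<close> the span of \<^term>\<open>Delta\<close> and the
  \<^term>\<open>Lambda r\<close> with \<open>r \<in> {0..<p}\<close>, the latter standing for \<open>\<Lambda>\<close> indexed by
  the class of \<open>r\<close> mod \<open>p\<close>.
\<close>
datatype P_gen = Gamma int | Delta | Lambda int

text \<open>For \<open>p > 0\<close>, the decomposition \<open>a = p d + s\<close> with \<open>s \<in> {1..p}\<close> is unique.\<close>
definition gamma :: "nat \<Rightarrow> int \<Rightarrow> (P_gen \<Rightarrow>\<^sub>0 int)" where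
  "gamma p a =
    (if p = 0 then frag_of (Gamma a)
     else
       let d = (a - 1) div int p; s = (a - 1) mod int p + 1
       in frag_of (Lambda (s mod int p)) - frag_of (Lambda ((s - 1) mod int p))
            - frag_cmul d (frag_of Delta))"

lemma gamma_decomposition:
  assumes "p > 0" "s \<in> {1..int p}"
  shows "gamma p (int p * d + s) =
    frag_of (Lambda (s mod int p)) - frag_of (Lambda ((s - 1) mod int p))
      - frag_cmul d (frag_of Delta)"
proof -
  have eq: "int p * d + s - 1 = (s - 1) + int p * d" by simp
  have "(int p * d + s - 1) div int p = d" "(int p * d + s - 1) mod int p = s - 1"
    unfolding eq using assms by (simp_all add: div_pos_pos_trivial)
  then show ?thesis using assms(1) by (simp add: gamma_def)
qed

definition crystal_of_parity ::
    "nat \<Rightarrow> nat \<Rightarrow> (nat \<Rightarrow> bit) \<Rightarrow> (nat \<Rightarrow>\<^sub>0 int, int, P_gen \<Rightarrow>\<^sub>0 int) crystal" where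
  "crystal_of_parity p N w =
    \<lparr> elems = weights N,
      wt_of = (\<lambda>l. \<Sum>j = 1..N.
        frag_cmul (parity_sign (w j)) (gamma p (bform w N (l + rho w N) (frag_of j)))),
      eps_of = (\<lambda>r l. card (minus_positions p w N r l)),
      phi_of = (\<lambda>r l. card (plus_positions p w N r l)),
      e_op = (\<lambda>r l. if minus_positions p w N r l = {} then None
        else Some (l - frag_of (Min (minus_positions p w N r l)))),
      f_op = (\<lambda>r l. if plus_positions p w N r l = {} then None
        else Some (l + frag_of (Max (plus_positions p w N r l)))) \<rparr>"

definition odd_reflection ::
    "nat \<Rightarrow> nat \<Rightarrow> (nat \<Rightarrow> bit) \<Rightarrow> nat \<Rightarrow> (nat \<Rightarrow>\<^sub>0 int) \<Rightarrow> (nat \<Rightarrow>\<^sub>0 int)" where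
  "odd_reflection p N v i l =
    (if [bform v N l (frag_of i - frag_of (i + 1)) = 0] (mod int p)
     then perm_act (transpose i (i + 1)) l
     else perm_act (transpose i (i + 1)) l - frag_of (i + 1) + frag_of i)"

end

theory Submission
  imports Defs
begin

text \<open>
  Only the positions \<open>i\<close> and \<open>i + 1\<close> of the signatures have to be compared. If
  \<open>(\<lambda>, \<epsilon>\<^sub>i - \<epsilon>\<^sub>i\<^sub>+\<^sub>1)\<close> vanishes mod \<open>p\<close> (\<open>atypical\<close> below), the signs there are \<open>+,-\<close> for both parity
  sequences, or for each of them a cancelling pair \<open>-,+\<close> or zeros, so the reduced signatures coincide.
  Otherwise they are never opposite, and the odd reflection interchanges them; if one of them is
  zero, this commutes with reduction, and if both are equal, nothing happens to the signature.
  In the last case the crystal operators can reach only position \<open>i + 1\<close> (for \<open>f\<close>) or \<open>i\<close> (for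
  \<open>e\<close>) and make the weight atypical, which compensates the missing transposition.
  Inverse to the odd reflection is the odd reflection of the interchanged sequence.
\<close>

subsection \<open>Reduction of signatures\<close>

lemma finite_support_cancel:
  assumes "cancel s t" and "finite {j. s j \<noteq> Zero}"
  shows "finite {j. t j \<noteq> Zero}"
  using assms(1)
proof cases
  case (1 j k)
  then have "{j. t j \<noteq> Zero} \<subseteq> {j. s j \<noteq> Zero}" by auto
  then show ?thesis using assms(2) finite_subset by blast
qed

lemma is_reduction_reduce:
  assumes "finite {j. s j \<noteq> Zero}"
  shows "is_reduction s (reduce s)"
  unfolding reduce_def by (rule theI'[OF ex1_is_reduction[OF assms]])

lemma reduce_eqI:
  assumes "finite {j. s j \<noteq> Zero}" and "is_reduction s t"
  shows "reduce s = t"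
  using ex1_is_reduction[OF assms(1)] is_reduction_reduce[OF assms(1)] assms(2) by blast

lemma reduce_cancel:
  assumes "cancel s t" and "finite {j. s j \<noteq> Zero}"
  shows "reduce s = reduce t"
proof (rule reduce_eqI[OF assms(2)])
  have "is_reduction t (reduce t)"
    by (rule is_reduction_reduce[OF finite_support_cancel[OF assms]])
  with assms(1) show "is_reduction s (reduce t)"
    unfolding is_reduction_def by (meson converse_rtranclp_into_rtranclp)
qed

text \<open>A cancellation only ever writes \<open>Zero\<close>, so a sign that survives has never
  been touched.\<close>

lemma cancel_sign_imp:
  assumes "cancel\<^sup>*\<^sup>* s t" and "t j \<noteq> Zero"
  shows "s j = t j"
  using assms
proof (induction rule: rtranclp_induct)
  case (step t u)
  then show ?case by (auto elim!: cancel.cases split: if_splits)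
qed simp

lemma reduce_sign_imp:
  assumes "finite {j. s j \<noteq> Zero}" and "reduce s j \<noteq> Zero"
  shows "s j = reduce s j"
  using is_reduction_reduce[OF assms(1)] assms(2) cancel_sign_imp
  unfolding is_reduction_def by blast

text \<open>With a \<open>Zero\<close> at \<open>i\<close> or \<open>Suc i\<close>, the interchange
  merely moves a sign past a zero. The nonzero signs keep their order, so the cancelling pair stays
  a cancelling pair.\<close>

lemma cancel_transpose:
  assumes "cancel s t" and z: "s i = Zero \<or> s (Suc i) = Zero"
  shows "cancel (s \<circ> transpose i (Suc i)) (t \<circ> transpose i (Suc i))"
  using assms(1)
proof cases
  case (1 j k)
  let ?x = "transpose i (Suc i)"
  have "cancel (s \<circ> ?x) ((s \<circ> ?x)(?x j := Zero, ?x k := Zero))"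
  proof (rule cancel.intros)
    show "?x j < ?x k" using 1 z by (auto simp: transpose_def)
    show "\<forall>a \<in> {?x j<..<?x k}. (s \<circ> ?x) a = Zero"
    proof
      fix a assume "a \<in> {?x j<..<?x k}"
      then show "(s \<circ> ?x) a = Zero"
        using 1 z by (cases "?x a \<in> {j<..<k}") (auto simp: transpose_def split: if_splits)
    qed
  qed (use 1 in auto)
  moreover have "(s \<circ> ?x)(?x j := Zero, ?x k := Zero) = t \<circ> ?x"
    unfolding 1(1) by (auto simp: fun_eq_iff transpose_def)
  ultimately show ?thesis by simp
qed

lemma reduce_transpose:
  assumes fin: "finite {j. s j \<noteq> Zero}" and z: "s i = Zero \<or> s (Suc i) = Zero"
  shows "reduce (s \<circ> transpose i (Suc i)) = reduce s \<circ> transpose i (Suc i)"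
proof (rule reduce_eqI)
  let ?x = "transpose i (Suc i)" and ?t = "reduce s"
  have "{j. (s \<circ> ?x) j \<noteq> Zero} = ?x ` {j. s j \<noteq> Zero}"
    by (force simp: image_iff intro: transpose_involutory[symmetric])
  then show "finite {j. (s \<circ> ?x) j \<noteq> Zero}" using fin by simp
  have red: "cancel\<^sup>*\<^sup>* s ?t" "\<not> (\<exists>j k. j < k \<and> ?t j = Minus \<and> ?t k = Plus)"
    using is_reduction_reduce[OF fin] by (auto simp: is_reduction_def)
  \<comment> \<open>Zeros persist along a reduction, so \<open>cancel_transpose\<close> applies to
    each of its steps and not only to the first.\<close>
  have zero: "t i = Zero \<or> t (Suc i) = Zero" if "cancel\<^sup>*\<^sup>* s t" for t
    using cancel_sign_imp[OF that] z by metis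
  from red(1) have "cancel\<^sup>*\<^sup>* (s \<circ> ?x) (?t \<circ> ?x)"
  proof (induction rule: rtranclp_induct)
    case (step t u)
    then show ?case using cancel_transpose zero by (meson rtranclp.rtrancl_into_rtrancl)
  qed simp
  moreover have "\<not> (\<exists>j k. j < k \<and> (?t \<circ> ?x) j = Minus \<and> (?t \<circ> ?x) k = Plus)"
  proof
    assume "\<exists>j k. j < k \<and> (?t \<circ> ?x) j = Minus \<and> (?t \<circ> ?x) k = Plus"
    then obtain j k where jk: "j < k" "?t (?x j) = Minus" "?t (?x k) = Plus" by auto
    \<comment> \<open>The interchange could reverse the order of \<open>j\<close> and
      \<open>k\<close> only if they were \<open>i\<close> and \<open>Suc i\<close>, but one of these
      carries \<open>Zero\<close>.\<close>
    then have "?x j < ?x k" using zero[OF red(1)] by (auto simp: transpose_def split: if_splits)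
    with jk red(2) show False by blast
  qed
  ultimately show "is_reduction (s \<circ> ?x) (?t \<circ> ?x)" by (simp add: is_reduction_def)
qed

text \<open>In a block of adjacent equal signs the inner ones, next to the cancelling partner,
  go first.\<close>

lemma reduce_adjacent_Plus:
  assumes fin: "finite {j. s j \<noteq> Zero}" and "s (Suc i) = Plus" and "reduce s i = Plus"
  shows "reduce s (Suc i) = Plus"
proof -
  have "cancel\<^sup>*\<^sup>* s (reduce s)"
    using is_reduction_reduce[OF fin] by (simp add: is_reduction_def)
  then have "reduce s i = Plus \<longrightarrow> reduce s (Suc i) = Plus"
  proof (induction rule: rtranclp_induct)
    case (step t u)
    from step(2) show ?case
    proof cases
      case (1 j k)
      \<comment> \<open>If the step deleted the \<open>Plus\<close> at \<open>Suc i\<close> and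
        spared the one at \<open>i\<close>, then \<open>i\<close> would lie strictly between the
        cancelling partners and would have to be zero.\<close>
      then show ?thesis using step(3) by (cases "i \<in> {j<..<k}") auto
    qed
  qed (use assms in simp)
  with assms show ?thesis by simp
qed

lemma reduce_adjacent_Minus:
  assumes fin: "finite {j. s j \<noteq> Zero}" and "s i = Minus" and "reduce s (Suc i) = Minus"
  shows "reduce s i = Minus"
proof -
  have "cancel\<^sup>*\<^sup>* s (reduce s)"
    using is_reduction_reduce[OF fin] by (simp add: is_reduction_def)
  then have "reduce s (Suc i) = Minus \<longrightarrow> reduce s i = Minus"
  proof (induction rule: rtranclp_induct)
    case (step t u)
    from step(2) show ?case
    proof cases
      case (1 j k)
      then show ?thesis using step(3) by (cases "Suc i \<in> {j<..<k}") auto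
    qed
  qed (use assms in simp)
  with assms show ?thesis by simp
qed

text \<open>The hypotheses leave two possibilities: \<open>Minus\<close>, \<open>Plus\<close>, which
  cancels at once because nothing lies in between, or two zeros, where clearing changes
  nothing.\<close>

lemma reduce_clear_pair:
  assumes fin: "finite {j. s j \<noteq> Zero}" and "s i = Minus \<longleftrightarrow> s (Suc i) = Plus"
    and "s i \<noteq> Plus" and "s (Suc i) \<noteq> Minus"
  shows "reduce s = reduce (s(i := Zero, Suc i := Zero))"
proof (cases "s i = Minus")
  case True
  with assms show ?thesis by (intro reduce_cancel cancel.intros) auto
next
  case False
  with assms have "s i = Zero" "s (Suc i) = Zero"
    by (metis sign.exhaust)+
  then have "s(i := Zero, Suc i := Zero) = s" by (simp add: fun_eq_iff)
  then show ?thesis by simp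
qed

text \<open>An adjacent transposition is monotone on a set that does not contain both of the
  exchanged points.\<close>

lemma Max_transpose_image:
  fixes A :: "nat set"
  assumes "finite A" "A \<noteq> {}" "i \<notin> A \<or> Suc i \<notin> A"
  shows "Max (transpose i (Suc i) ` A) = transpose i (Suc i) (Max A)"
proof (rule Max_eqI)
  fix y assume "y \<in> transpose i (Suc i) ` A"
  then obtain a where a: "a \<in> A" "y = transpose i (Suc i) a" by auto
  have "a \<le> Max A" "Max A \<in> A" using a assms by auto
  with a assms(3) show "y \<le> transpose i (Suc i) (Max A)"
    by (cases "a = Max A") (auto simp: transpose_def)
qed (use assms in auto)

lemma Min_transpose_image:
  fixes A :: "nat set"
  assumes "finite A" "A \<noteq> {}" "i \<notin> A \<or> Suc i \<notin> A"
  shows "Min (transpose i (Suc i) ` A) = transpose i (Suc i) (Min A)"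
proof (rule Min_eqI)
  fix y assume "y \<in> transpose i (Suc i) ` A"
  then obtain a where a: "a \<in> A" "y = transpose i (Suc i) a" by auto
  have "Min A \<le> a" "Min A \<in> A" using a assms by auto
  with a assms(3) show "transpose i (Suc i) (Min A) \<le> y"
    by (cases "a = Min A") (auto simp: transpose_def)
qed (use assms in auto)


subsection \<open>Weights and residues\<close>

text \<open>Evaluating at \<open>x j\<close> avoids the inverse of \<open>x\<close>; by injectivity
  only the basis element at \<open>j\<close> contributes there.\<close>

lemma lookup_perm_act:
  assumes "inj x"
  shows "Poly_Mapping.lookup (perm_act x l) (x j) = Poly_Mapping.lookup l j"
proof -
  have "Poly_Mapping.lookup (perm_act x l) (x j) =
      (\<Sum>a\<in>Poly_Mapping.keys l. if a = j then Poly_Mapping.lookup l a else 0)"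
    unfolding perm_act_def frag_extend_def lookup_sum
    by (rule sum.cong) (auto simp: lookup_single when_def inj_eq[OF assms])
  also have "\<dots> = Poly_Mapping.lookup l j"
    by (simp add: in_keys_iff)
  finally show ?thesis .
qed

lemma lookup_perm_act_transpose:
  "Poly_Mapping.lookup (perm_act (transpose i k) l) j = Poly_Mapping.lookup l (transpose i k j)"
  using lookup_perm_act[OF inj_transpose, of i k l "transpose i k j"] by simp

lemma weights_iff: "l \<in> weights N \<longleftrightarrow> (\<forall>j. j \<notin> {1..N} \<longrightarrow> Poly_Mapping.lookup l j = 0)"
  by (auto simp: weights_def in_keys_iff)

lemma parity_sign_add: "parity_sign (x + y) = parity_sign x * parity_sign y"
  by (cases x; cases y) (auto simp: parity_sign_def)

lemma parity_sign_square: "parity_sign x * parity_sign x = 1"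
  by (simp add: parity_sign_def)

lemma bform_frag_of:
  assumes "j \<in> {1..N}"
  shows "bform w N l (frag_of j) = parity_sign (w j) * Poly_Mapping.lookup l j"
proof -
  have "bform w N l (frag_of j) =
      (\<Sum>a = 1..N. if j = a then parity_sign (w a) * Poly_Mapping.lookup l a else 0)"
    unfolding bform_def by (rule sum.cong) (auto)
  then show ?thesis using assms by simp
qed

text \<open>This is \<open>vartheta_coeff\<close> without its factor
  \<open>parity_sign (w j)\<close>. The form multiplies by the same factor, whose square is 1, so
  the tail enters the residue unsigned.\<close>

definition sign_tail :: "(nat \<Rightarrow> bit) \<Rightarrow> nat \<Rightarrow> nat \<Rightarrow> int" where
  "sign_tail w N j = (\<Sum>a = Suc j..N. parity_sign (w a))"

lemma lookup_vartheta:
  assumes "j \<in> {1..N}"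
  shows "Poly_Mapping.lookup (vartheta w N) j = parity_sign (w j) * sign_tail w N j"
proof -
  have "Poly_Mapping.lookup (vartheta w N) j =
      (\<Sum>a = 1..N. if a = j then vartheta_coeff w N a else 0)"
    unfolding vartheta_def lookup_sum by (rule sum.cong) (auto)
  also have "\<dots> = vartheta_coeff w N j" using assms by simp
  also have "\<dots> = parity_sign (w j) * sign_tail w N j"
    by (simp add: vartheta_coeff_def sign_tail_def parity_sign_add sum_distrib_left mult.commute
        del: add_bit_eq_xor)
  finally show ?thesis .
qed

lemma residue_eq:
  assumes "j \<in> {1..N}"
  shows "residue w N j l = parity_sign (w j) * Poly_Mapping.lookup l j + sign_tail w N j"
proof -
  have "residue w N j l = parity_sign (w j) * Poly_Mapping.lookup l j
      + (parity_sign (w j) * parity_sign (w j)) * sign_tail w N j"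
    by (simp add: residue_def bform_frag_of[OF assms] lookup_add lookup_vartheta[OF assms]
        distrib_left mult.assoc)
  then show ?thesis by (simp add: parity_sign_square)
qed

lemma bform_rho:
  assumes "j \<in> {1..N}"
  shows "bform w N (l + rho w N) (frag_of j) = residue w N j l + (if w j = 0 then 1 else 0)"
proof -
  have "Poly_Mapping.lookup (\<Sum>a \<in> {a \<in> {1..N}. w a = 0}. frag_of a) j =
      (\<Sum>a \<in> {a \<in> {1..N}. w a = 0}. if a = j then 1 else (0::int))"
    unfolding lookup_sum by (rule sum.cong) (auto)
  also have "\<dots> = (if w j = 0 then 1 else 0)" using assms by simp
  finally show ?thesis
    by (simp add: residue_def rho_def bform_frag_of[OF assms] lookup_add distrib_left
        parity_sign_def)
qed

lemma signature_eq:
  assumes "j \<in> {1..N}"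
  shows "signature p w N r l j =
    (let c = parity_sign (w j) * Poly_Mapping.lookup l j + sign_tail w N j in
      if [c + parity_sign (w j) = r] (mod int p) then Plus
      else if [c = r] (mod int p) then Minus else Zero)"
  using assms
  by (simp add: signature_def residue_eq lookup_add Let_def algebra_simps)

lemma finite_signature: "finite {j. signature p w N r l j \<noteq> Zero}"
proof -
  have "{j. signature p w N r l j \<noteq> Zero} \<subseteq> {1..N}" by (auto simp: signature_def)
  then show ?thesis using finite_subset by blast
qed

text \<open>For \<open>p > 0\<close>, adding \<open>p * k\<close> to the index subtracts k times
  \<open>Delta\<close>, whatever the index is, so this contribution to the difference does not
  depend on \<open>c\<close>.\<close>

lemma gamma_shift:
  assumes "[a = b] (mod int p)"
  shows "gamma p (a + c) - gamma p (b + c) = gamma p a - gamma p b"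
proof (cases "p = 0")
  case True
  with assms show ?thesis by simp
next
  case False
  obtain k where k: "a = b + int p * k" using cong_sym[OF assms] unfolding cong_iff_lin by blast
  have shift: "gamma p (x + int p * k) = gamma p x - frag_cmul k (frag_of Delta)" for x
  proof -
    have "x + int p * k - 1 = (x - 1) + int p * k" by simp
    then have "(x + int p * k - 1) div int p = (x - 1) div int p + k"
      and "(x + int p * k - 1) mod int p = (x - 1) mod int p"
      using False by (simp_all only: div_mult_self2 mod_mult_self2 of_nat_eq_0_iff not_False_eq_True)
    then show ?thesis using False
      by (simp add: gamma_def Let_def frag_cmul_distrib)
  qed
  have ac: "a + c = (b + c) + int p * k" using k by simp
  show ?thesis unfolding ac unfolding k by (simp add: shift)
qed

lemma sum_transpose_eq:
  assumes "i \<in> A" "k \<in> A"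
  shows "(\<Sum>a\<in>A. f (transpose i k a)) = (\<Sum>a\<in>A. f a)"
  using assms by (intro sum.reindex_bij_betw bij_betw_transpose_iff) simp

lemma perm_act_add: "perm_act x (l + u) = perm_act x l + perm_act x u"
  by (simp add: perm_act_def frag_extend_add)

lemma perm_act_diff: "perm_act x (l - u) = perm_act x l - perm_act x u"
  by (simp add: perm_act_def frag_extend_diff)

lemma perm_act_frag_of [simp]: "perm_act x (frag_of j) = frag_of (x j)"
  by (simp add: perm_act_def)


subsection \<open>Odd reflections\<close>

locale odd_pair =
  fixes p N i :: nat and v :: "nat \<Rightarrow> bit"
  assumes p_neq_1: "p \<noteq> 1" and i_ge: "1 \<le> i" and i_less: "Suc i \<le> N"
    and odd: "v i \<noteq> v (Suc i)"
begin

abbreviation "x \<equiv> transpose i (Suc i)"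
abbreviation "w \<equiv> v \<circ> x"
abbreviation "reflect \<equiv> odd_reflection p N v i"
abbreviation "lk \<equiv> Poly_Mapping.lookup :: (nat \<Rightarrow>\<^sub>0 int) \<Rightarrow> nat \<Rightarrow> int"
abbreviation "s \<equiv> parity_sign (v i)"

text \<open>The form has opposite signs at \<open>i\<close> and \<open>Suc i\<close>, so pairing
  with \<open>frag_of i - frag_of (i + 1)\<close> gives the sum of the two coordinates up to
  sign.\<close>

definition atypical :: "(nat \<Rightarrow>\<^sub>0 int) \<Rightarrow> bool" where
  "atypical l \<longleftrightarrow> int p dvd lk l i + lk l (Suc i)"

lemma in_range: "i \<in> {1..N}" "Suc i \<in> {1..N}"
  using i_ge i_less by auto

lemma not_dvd_1: "\<not> int p dvd 1"
  using p_neq_1 by simp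

lemma dvd_sign: "int p dvd s * z \<longleftrightarrow> int p dvd z"
  by (simp add: parity_sign_def)

lemma sign_Suc: "parity_sign (v (Suc i)) = - s"
  using odd by (cases "v i"; cases "v (Suc i)") (auto simp: parity_sign_def)

section \<open>The odd reflection as a bijection of the weight lattice\<close>

lemma reflect_eq:
  "reflect l = perm_act x l + (if atypical l then 0 else frag_of i - frag_of (Suc i))"
proof -
  have "bform v N l (frag_of i - frag_of (i + 1)) =
      bform v N l (frag_of i) - bform v N l (frag_of (Suc i))"
    by (simp add: bform_def lookup_minus right_diff_distrib sum_subtractf)
  also have "\<dots> = s * (lk l i + lk l (Suc i))"
    by (simp only: bform_frag_of[OF in_range(1)] bform_frag_of[OF in_range(2)] sign_Suc)
      (simp add: algebra_simps)
  finally have "[bform v N l (frag_of i - frag_of (i + 1)) = 0] (mod int p) \<longleftrightarrow> atypical l"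
    by (simp only: cong_0_iff dvd_sign atypical_def)
  then show ?thesis by (simp add: odd_reflection_def)
qed

lemma lookup_reflect:
  "lk (reflect l) i = lk l (Suc i) + (if atypical l then 0 else 1)"
  "lk (reflect l) (Suc i) = lk l i - (if atypical l then 0 else 1)"
  "j \<noteq> i \<Longrightarrow> j \<noteq> Suc i \<Longrightarrow> lk (reflect l) j = lk l j"
  by (simp_all add: reflect_eq lookup_add lookup_minus lookup_perm_act_transpose)

text \<open>Every result of the locale thereby holds for the interchanged sequence too, with
  \<open>s\<close> replaced by \<open>- s\<close>.\<close>

lemma odd_pair_w: "odd_pair p N i w"
  using p_neq_1 i_ge i_less odd by unfold_locales auto

lemma w_transpose: "w \<circ> x = v"
  by (simp add: fun_eq_iff)

lemma atypical_reflect: "odd_pair.atypical p i (reflect l) \<longleftrightarrow> atypical l"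
  by (simp add: odd_pair.atypical_def[OF odd_pair_w] atypical_def lookup_reflect add.commute)

text \<open>The sum of the coordinates at \<open>i\<close> and \<open>Suc i\<close> is preserved, so
  both reflections are in the same case; after the interchange the two corrections cancel.\<close>

lemma reflect_reflect: "odd_reflection p N w i (reflect l) = l"
proof (rule poly_mapping_eqI)
  fix j
  note L = odd_pair.lookup_reflect[OF odd_pair_w, where l = "reflect l"]
  show "lk (odd_reflection p N w i (reflect l)) j = lk l j"
    by (cases "j = i"; cases "j = Suc i") (simp_all add: L lookup_reflect atypical_reflect)
qed

lemma reflect_weights: "l \<in> weights N \<Longrightarrow> reflect l \<in> weights N"
  unfolding weights_iff using in_range lookup_reflect(3) by metis

lemma reflect_bij: "bij_betw reflect (weights N) (weights N)"
proof (rule bij_betw_byWitness[where f' = "odd_reflection p N w i"])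
  show "\<forall>l\<in>weights N. reflect (odd_reflection p N w i l) = l"
    \<comment> \<open>Interchanging twice returns \<open>v\<close>, so the same lemma for
      \<open>w\<close> gives the inverse on the other side.\<close>
    using odd_pair.reflect_reflect[OF odd_pair_w] by (simp only: w_transpose) simp
  show "odd_reflection p N w i ` weights N \<subseteq> weights N"
    using odd_pair.reflect_weights[OF odd_pair_w] by blast
qed (auto simp: reflect_reflect reflect_weights)

section \<open>Residues and crystal weights at the interchanged positions\<close>

abbreviation "T \<equiv> sign_tail v N (Suc i)"

lemma sign_tail_i: "sign_tail v N i = T - s"
  using i_less by (simp add: sign_tail_def sum.atLeast_Suc_atMost sign_Suc)

lemma sign_tail_w_Suc: "sign_tail w N (Suc i) = T"
  unfolding sign_tail_def by (rule sum.cong) auto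

text \<open>A tail starting before \<open>i\<close> contains both exchanged positions, and one
  starting after \<open>Suc i\<close> neither; only the tail from \<open>i\<close> separates
  them.\<close>

lemma sign_tail_w:
  assumes "j \<noteq> i"
  shows "sign_tail w N j = sign_tail v N j"
proof (cases "j < i")
  case True
  then show ?thesis unfolding sign_tail_def comp_apply
    using i_less by (intro sum_transpose_eq[where f = "\<lambda>a. parity_sign (v a)"]) auto
next
  case False
  with assms show ?thesis unfolding sign_tail_def by (intro sum.cong) auto
qed

lemma residue_pair:
  "residue v N i l = s * lk l i + (T - s)"
  "residue v N (Suc i) l = - s * lk l (Suc i) + T"
  by (simp_all only: residue_eq[OF in_range(1)] residue_eq[OF in_range(2)] sign_Suc sign_tail_i)

lemma residue_pair_w:
  "residue w N i l = - s * lk l i + T + s"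
  "residue w N (Suc i) l = s * lk l (Suc i) + T"
  using odd_pair.residue_pair[OF odd_pair_w, of l]
  by (simp_all add: sign_Suc sign_tail_w_Suc)

lemma residue_other:
  assumes "j \<in> {1..N}" "j \<noteq> i" "j \<noteq> Suc i"
  shows "residue w N j (reflect l) = residue v N j l"
  using assms by (simp add: residue_eq sign_tail_w lookup_reflect)

lemma wt_reflect:
  "wt_of (crystal_of_parity p N w) (reflect l) = wt_of (crystal_of_parity p N v) l"
proof -
  define F where "F u k j = frag_cmul (parity_sign (u j))
    (gamma p (residue u N j k + (if u j = 0 then 1 else 0)))" for u :: "nat \<Rightarrow> bit" and k j
  have wt: "wt_of (crystal_of_parity p N u) k =
      F u k i + F u k (Suc i) + sum (F u k) ({1..N} - {i, Suc i})" for u k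
  proof -
    have "wt_of (crystal_of_parity p N u) k = sum (F u k) {1..N}"
      unfolding crystal_of_parity_def F_def by (simp add: bform_rho)
    also have "\<dots> = sum (F u k) {i, Suc i} + sum (F u k) ({1..N} - {i, Suc i})"
      using in_range by (subst sum.subset_diff[of "{i, Suc i}"]) (auto simp: add.commute)
    finally show ?thesis by simp
  qed
  have other: "sum (F w (reflect l)) ({1..N} - {i, Suc i}) = sum (F v l) ({1..N} - {i, Suc i})"
    by (rule sum.cong) (auto simp: F_def residue_other)
  \<comment> \<open>Up to a common shift by 0 or 1, these are the indices of \<open>gamma\<close> at
    \<open>i\<close> and \<open>Suc i\<close>, and the two terms carry opposite signs. A typical
    reflection exchanges the terms. An atypical one also changes the common shift by 1, which
    \<open>gamma_shift\<close> permits since \<open>a\<close> and \<open>b\<close> are then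
    congruent.\<close>
  define a b where "a = s * lk l i + T" and "b = - s * lk l (Suc i) + T"
  have ab: "[a = b] (mod int p)" if "atypical l"
  proof -
    have "a - b = s * (lk l i + lk l (Suc i))" by (simp add: a_def b_def algebra_simps)
    then show ?thesis using that by (simp only: cong_iff_dvd_diff dvd_sign atypical_def)
  qed
  have pair: "F w (reflect l) i + F w (reflect l) (Suc i) = F v l i + F v l (Suc i)"
  proof (cases "v i = 0")
    case True
    then have "v (Suc i) = 1" using odd by auto
    then show ?thesis using True gamma_shift[OF ab, of 1]
      by (cases "atypical l") (simp_all add: F_def residue_pair residue_pair_w lookup_reflect
          a_def b_def parity_sign_def algebra_simps)
  next
    case False
    then have "v (Suc i) = 0" "v i = 1" using odd by auto
    then show ?thesis using gamma_shift[OF ab, of 1]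
      by (cases "atypical l") (simp_all add: F_def residue_pair residue_pair_w lookup_reflect
          a_def b_def parity_sign_def algebra_simps)
  qed
  show ?thesis unfolding wt other pair ..
qed

section \<open>Signatures at the interchanged positions\<close>

lemma signature_iff:
  assumes "j \<in> {1..N}"
  shows "signature p u N r l j = Plus \<longleftrightarrow>
      int p dvd residue u N j l + parity_sign (u j) - r" (is "?P \<longleftrightarrow> ?P'")
    and "signature p u N r l j = Minus \<longleftrightarrow> int p dvd residue u N j l - r" (is "?M \<longleftrightarrow> ?M'")
proof -
  have plus: "residue u N j (l + frag_of j) = residue u N j l + parity_sign (u j)"
    using assms by (simp add: residue_eq lookup_add distrib_left)
  \<comment> \<open>The two conditions differ by a sign, which is nonzero mod \<open>p\<close>. So
    the order of the tests in \<open>signature\<close> is irrelevant, and each sign is a single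
    divisibility condition.\<close>
  have excl: "\<not> (?P' \<and> ?M')"
  proof
    assume "?P' \<and> ?M'"
    then have "int p dvd (residue u N j l + parity_sign (u j) - r) - (residue u N j l - r)"
      by (elim conjE) (rule dvd_diff)
    then show False using not_dvd_1 by (simp add: parity_sign_def split: if_splits)
  qed
  have "signature p u N r l j = (if ?P' then Plus else if ?M' then Minus else Zero)"
    using assms by (simp add: signature_def plus cong_iff_dvd_diff)
  with excl show "?P \<longleftrightarrow> ?P'" "?M \<longleftrightarrow> ?M'"
    by (metis sign.distinct)+
qed

lemma signature_pair:
  "signature p v N r l i = Plus \<longleftrightarrow> int p dvd s * lk l i + T - r"
  "signature p v N r l i = Minus \<longleftrightarrow> int p dvd s * lk l i + T - s - r"
  "signature p v N r l (Suc i) = Plus \<longleftrightarrow> int p dvd - s * lk l (Suc i) + T - s - r"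
  "signature p v N r l (Suc i) = Minus \<longleftrightarrow> int p dvd - s * lk l (Suc i) + T - r"
  unfolding signature_iff[OF in_range(1)] signature_iff[OF in_range(2)] residue_pair sign_Suc
  by (simp_all add: algebra_simps)

lemma signature_pair_w:
  "signature p w N r l i = Plus \<longleftrightarrow> int p dvd - s * lk l i + T - r"
  "signature p w N r l i = Minus \<longleftrightarrow> int p dvd - s * lk l i + T + s - r"
  "signature p w N r l (Suc i) = Plus \<longleftrightarrow> int p dvd s * lk l (Suc i) + T + s - r"
  "signature p w N r l (Suc i) = Minus \<longleftrightarrow> int p dvd s * lk l (Suc i) + T - r"
  unfolding signature_iff[OF in_range(1)] signature_iff[OF in_range(2)] residue_pair_w
  by (simp_all add: algebra_simps sign_Suc)

lemma signature_other:
  assumes "j \<noteq> i" "j \<noteq> Suc i"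
  shows "signature p w N r (reflect l) j = signature p v N r l j"
proof (cases "j \<in> {1..N}")
  case True
  then show ?thesis using assms
    by (simp add: signature_eq sign_tail_w lookup_reflect Let_def)
next
  case False
  then show ?thesis by (simp add: signature_def)
qed

lemma sign_eqI:
  assumes "a = Plus \<longleftrightarrow> b = Plus" and "a = Minus \<longleftrightarrow> b = Minus"
  shows "a = b"
  using assms by (cases a; cases b) auto

text \<open>The conditions for \<open>v\<close> and \<open>w\<close> carry \<open>s\<close> at
  different places; the correction \<open>frag_of i - frag_of (Suc i)\<close> offsets exactly this
  discrepancy.\<close>

lemma signature_typical:
  assumes "\<not> atypical l"
  shows "signature p w N r (reflect l) = signature p v N r l \<circ> x"
proof
  fix j
  consider "j = i" | "j = Suc i" | "j \<noteq> i" "j \<noteq> Suc i" by blast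
  then show "signature p w N r (reflect l) j = (signature p v N r l \<circ> x) j"
  proof cases
    case 1
    show ?thesis unfolding 1
      by (rule sign_eqI) (use assms in \<open>simp_all add: signature_pair signature_pair_w lookup_reflect
        algebra_simps\<close>)
  next
    case 2
    show ?thesis unfolding 2
      by (rule sign_eqI) (use assms in \<open>simp_all add: signature_pair signature_pair_w lookup_reflect
        algebra_simps\<close>)
  next
    case 3
    then show ?thesis by (simp add: signature_other)
  qed
qed

lemma atypical_iff: "atypical l \<longleftrightarrow> int p dvd s * lk l i + s * lk l (Suc i)"
  unfolding atypical_def by (simp only: dvd_sign flip: distrib_left)

text \<open>Subtracting the divisibility conditions of two opposite signs would make the weight
  atypical.\<close>

lemma signature_typical_pair:
  assumes "\<not> atypical l"
  shows "signature p v N r l i = Zero \<or> signature p v N r l (Suc i) = Zero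
    \<or> signature p v N r l i = signature p v N r l (Suc i)"
proof -
  have "\<not> (signature p v N r l i = Plus \<and> signature p v N r l (Suc i) = Minus)"
  proof
    assume "signature p v N r l i = Plus \<and> signature p v N r l (Suc i) = Minus"
    then have "int p dvd s * lk l i + s * lk l (Suc i)" unfolding signature_pair by algebra
    with assms show False by (simp add: atypical_iff)
  qed
  moreover have "\<not> (signature p v N r l i = Minus \<and> signature p v N r l (Suc i) = Plus)"
  proof
    assume "signature p v N r l i = Minus \<and> signature p v N r l (Suc i) = Plus"
    then have "int p dvd s * lk l i + s * lk l (Suc i)" unfolding signature_pair by algebra
    with assms show False by (simp add: atypical_iff)
  qed
  ultimately show ?thesis
    by (cases "signature p v N r l i"; cases "signature p v N r l (Suc i)") auto
qed

text \<open>Atypicality makes \<open>s * lk l i\<close> and \<open>- s * lk l (Suc i)\<close>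
  congruent, so the conditions at the two positions match. The pair \<open>Minus\<close>,
  \<open>Plus\<close> may occur for different \<open>r\<close> before and after reflection; hence it
  is described separately for each signature and not compared.\<close>

lemma signature_atypical_pair:
  assumes "atypical l"
  shows "signature p v N r l i = Plus \<longleftrightarrow> signature p v N r l (Suc i) = Minus"
    "signature p v N r l i = Minus \<longleftrightarrow> signature p v N r l (Suc i) = Plus"
    "signature p w N r (reflect l) i = Plus \<longleftrightarrow> signature p v N r l i = Plus"
    "signature p w N r (reflect l) (Suc i) = Minus \<longleftrightarrow> signature p v N r l i = Plus"
    "signature p w N r (reflect l) i = Minus \<longleftrightarrow> signature p w N r (reflect l) (Suc i) = Plus"
  using assms unfolding signature_pair signature_pair_w atypical_iff
  by (simp_all add: lookup_reflect assms) (rule iffI; algebra)+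

section \<open>Reduced signatures under an odd reflection\<close>

lemma reduced_sign_imp:
  "reduced_signature p u N r l j \<noteq> Zero \<Longrightarrow> signature p u N r l j = reduced_signature p u N r l j"
  unfolding reduced_signature_def by (rule reduce_sign_imp[OF finite_signature])

text \<open>The last two claims tell which of the two positions an operator can reach: only
  \<open>i\<close> for f and only \<open>Suc i\<close> for e.\<close>

lemma reduced_signature_atypical:
  assumes "atypical l"
  shows "reduced_signature p w N r (reflect l) = reduced_signature p v N r l"
    and "reduced_signature p v N r l i \<noteq> Minus"
    and "reduced_signature p v N r l (Suc i) \<noteq> Plus"
proof -
  let ?S = "signature p v N r l" and ?S' = "signature p w N r (reflect l)"
  note pair = signature_atypical_pair[OF assms, of r]
  have "reduce ?S' = reduce ?S \<and> reduce ?S i \<noteq> Minus \<and> reduce ?S (Suc i) \<noteq> Plus"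
  proof (cases "?S i = Plus")
    case True
    then have Suc: "?S (Suc i) = Minus" and "?S' i = Plus" "?S' (Suc i) = Minus"
      using pair by simp_all
    then have "?S' j = ?S j" for j
      using True signature_other[of j r l] by (cases "j = i"; cases "j = Suc i") auto
    then have "?S' = ?S" by (rule ext)
    moreover have "reduce ?S i \<noteq> Minus" "reduce ?S (Suc i) \<noteq> Plus"
      using True Suc reduced_sign_imp[of v r l i] reduced_sign_imp[of v r l "Suc i"]
      by (auto simp: reduced_signature_def)
    ultimately show ?thesis by simp
  next
    case False
    \<comment> \<open>Clearing both positions gives one signature to which both sides reduce, since
      elsewhere they agree.\<close>
    let ?U = "?S(i := Zero, Suc i := Zero)"
    have S: "reduce ?S = reduce ?U"
      by (rule reduce_clear_pair[OF finite_signature]) (use False pair in auto)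
    have "reduce ?S' = reduce (?S'(i := Zero, Suc i := Zero))"
      by (rule reduce_clear_pair[OF finite_signature]) (use False pair in auto)
    also have "?S'(i := Zero, Suc i := Zero) = ?U"
      by (auto simp: fun_eq_iff signature_other)
    finally have S': "reduce ?S' = reduce ?U" .
    have "finite {j. ?U j \<noteq> Zero}"
      by (rule finite_subset[OF _ finite_signature[of p v N r l]]) auto
    then have "reduce ?U i = Zero" "reduce ?U (Suc i) = Zero"
      using reduce_sign_imp[of ?U i] reduce_sign_imp[of ?U "Suc i"] by fastforce+
    with S S' show ?thesis by simp
  qed
  then show "reduced_signature p w N r (reflect l) = reduced_signature p v N r l"
    "reduced_signature p v N r l i \<noteq> Minus" "reduced_signature p v N r l (Suc i) \<noteq> Plus"
    by (simp_all add: reduced_signature_def)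
qed

section \<open>Compatibility with the crystal operators\<close>

lemma reflect_add:
  assumes "atypical (l + u) \<longleftrightarrow> atypical l"
  shows "reflect (l + u) = reflect l + perm_act x u"
  using assms by (simp add: reflect_eq perm_act_add algebra_simps)

lemma reflect_diff:
  assumes "atypical (l - u) \<longleftrightarrow> atypical l"
  shows "reflect (l - u) = reflect l - perm_act x u"
  using assms by (simp add: reflect_eq perm_act_diff algebra_simps)

lemma atypical_add_frag_of:
  "j \<noteq> i \<Longrightarrow> j \<noteq> Suc i \<Longrightarrow> atypical (l + frag_of j) \<longleftrightarrow> atypical l"
  "j = i \<or> j = Suc i \<Longrightarrow> atypical (l + frag_of j) \<longleftrightarrow> int p dvd lk l i + lk l (Suc i) + 1"
  by (auto simp: atypical_def lookup_add algebra_simps)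

lemma atypical_diff_frag_of:
  "j \<noteq> i \<Longrightarrow> j \<noteq> Suc i \<Longrightarrow> atypical (l - frag_of j) \<longleftrightarrow> atypical l"
  "j = i \<or> j = Suc i \<Longrightarrow> atypical (l - frag_of j) \<longleftrightarrow> int p dvd lk l i + lk l (Suc i) - 1"
  by (auto simp: atypical_def lookup_minus algebra_simps)

text \<open>The hypothesis says that adding a basis element at \<open>i\<close> or
  \<open>Suc i\<close> makes the weight atypical. If just one of the two signs is
  \<open>Plus\<close>, this is therefore excluded; \<open>Plus_Plus_dvd\<close> is the counterpart
  for two.\<close>

lemma dvd_sum_add_1:
  assumes "int p dvd lk l i + lk l (Suc i) + 1"
  shows "signature p v N r l i = Plus \<longleftrightarrow> signature p v N r l (Suc i) = Plus"
proof -
  have "int p dvd s * (lk l i + lk l (Suc i) + 1)" using assms by simp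
  then show ?thesis unfolding signature_pair by (intro iffI; algebra)
qed

lemma dvd_sum_diff_1:
  assumes "int p dvd lk l i + lk l (Suc i) - 1"
  shows "signature p v N r l i = Minus \<longleftrightarrow> signature p v N r l (Suc i) = Minus"
proof -
  have "int p dvd s * (lk l i + lk l (Suc i) - 1)" using assms by simp
  then show ?thesis unfolding signature_pair by (intro iffI; algebra)
qed

lemma Plus_Plus_dvd:
  assumes "signature p v N r l i = Plus" "signature p v N r l (Suc i) = Plus"
  shows "int p dvd lk l i + lk l (Suc i) + 1"
proof -
  have "int p dvd s * (lk l i + lk l (Suc i) + 1)"
    using assms unfolding signature_pair by algebra
  then show ?thesis by (simp only: dvd_sign)
qed

lemma Minus_Minus_dvd:
  assumes "signature p v N r l i = Minus" "signature p v N r l (Suc i) = Minus"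
  shows "int p dvd lk l i + lk l (Suc i) - 1"
proof -
  have "int p dvd s * (lk l i + lk l (Suc i) - 1)"
    using assms unfolding signature_pair by algebra
  then show ?thesis by (simp only: dvd_sign)
qed

lemma atypical_not_dvd:
  assumes "atypical l"
  shows "\<not> int p dvd lk l i + lk l (Suc i) + 1" "\<not> int p dvd lk l i + lk l (Suc i) - 1"
  using assms not_dvd_1 unfolding atypical_def
  by (simp_all add: dvd_add_right_iff dvd_diff_right_iff)

lemma reduced_signature_typical:
  assumes "\<not> atypical l"
    and "signature p v N r l i = Zero \<or> signature p v N r l (Suc i) = Zero"
  shows "reduced_signature p w N r (reflect l) = reduced_signature p v N r l \<circ> x"
  unfolding reduced_signature_def signature_typical[OF assms(1)]
  by (rule reduce_transpose[OF finite_signature assms(2)])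

lemma reduced_signature_typical_eq:
  assumes "\<not> atypical l" and "signature p v N r l i = signature p v N r l (Suc i)"
  shows "reduced_signature p w N r (reflect l) = reduced_signature p v N r l"
proof -
  have "signature p v N r l \<circ> x = signature p v N r l"
    using assms(2) by (auto simp: fun_eq_iff transpose_def)
  then show ?thesis
    unfolding reduced_signature_def signature_typical[OF assms(1)] by simp
qed

lemma positions_transpose:
  assumes "reduced_signature p w N r l' = reduced_signature p v N r l \<circ> x"
  shows "plus_positions p w N r l' = x ` plus_positions p v N r l"
    and "minus_positions p w N r l' = x ` minus_positions p v N r l"
proof -
  have img: "{j \<in> {1..N}. Q (x j)} = x ` {j \<in> {1..N}. Q j}" for Q
  proof -
    have inr: "x j \<in> {1..N} \<longleftrightarrow> j \<in> {1..N}" for j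
      using in_range by (auto simp: transpose_def)
    show ?thesis
    proof (intro equalityI subsetI)
      fix j assume "j \<in> {j \<in> {1..N}. Q (x j)}"
      then have "x j \<in> {j \<in> {1..N}. Q j}" using inr[of j] by blast
      then have "x (x j) \<in> x ` {j \<in> {1..N}. Q j}" by (rule imageI)
      then show "j \<in> x ` {j \<in> {1..N}. Q j}" by (simp only: transpose_involutory)
    next
      fix j assume "j \<in> x ` {j \<in> {1..N}. Q j}"
      then obtain k where "j = x k" "k \<in> {1..N}" "Q k" by blast
      then show "j \<in> {j \<in> {1..N}. Q (x j)}" using inr[of k] by simp
    qed
  qed
  show "plus_positions p w N r l' = x ` plus_positions p v N r l"
    unfolding plus_positions_def assms comp_apply by (rule img)
  show "minus_positions p w N r l' = x ` minus_positions p v N r l"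
    unfolding minus_positions_def assms comp_apply by (rule img)
qed

lemma finite_positions:
  "finite (plus_positions p u N r l)" "finite (minus_positions p u N r l)"
  by (simp_all add: plus_positions_def minus_positions_def)

lemma plus_positionsD:
  assumes "j \<in> plus_positions p u N r l"
  shows "reduced_signature p u N r l j = Plus" "signature p u N r l j = Plus"
  using assms reduced_sign_imp[of u r l j] by (auto simp: plus_positions_def)

lemma minus_positionsD:
  assumes "j \<in> minus_positions p u N r l"
  shows "reduced_signature p u N r l j = Minus" "signature p u N r l j = Minus"
  using assms reduced_sign_imp[of u r l j] by (auto simp: minus_positions_def)

text \<open>The cardinalities account for \<open>phi_of\<close>. The equation says that
  \<open>f_op\<close> commutes with the reflection, the maximum being taken separately on each
  side.\<close>

lemma reflect_plus:
  defines "A \<equiv> \<lambda>r l. plus_positions p v N r l" and "B \<equiv> \<lambda>r l. plus_positions p w N r (reflect l)"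
  shows "card (B r l) = card (A r l) \<and> (A r l \<noteq> {} \<longrightarrow>
    reflect (l + frag_of (Max (A r l))) = reflect l + frag_of (Max (B r l)))"
proof -
  let ?S = "signature p v N r l" and ?k = "Max (A r l)"
  have k: "?k \<in> A r l" if "A r l \<noteq> {}"
    using that finite_positions unfolding A_def by (intro Max_in)
  note kD = plus_positionsD[OF k[unfolded A_def], folded A_def]
  consider (atypical) "atypical l"
    | (swap) "\<not> atypical l" "?S i = Zero \<or> ?S (Suc i) = Zero"
    | (equal) "\<not> atypical l" "?S i = ?S (Suc i)"
    using signature_typical_pair by blast
  then show ?thesis
  proof cases
    case atypical
    note red = reduced_signature_atypical[OF atypical, of r]
    have "B r l = A r l" unfolding A_def B_def plus_positions_def red(1) ..
    moreover have "reflect (l + frag_of ?k) = reflect l + frag_of ?k" if "A r l \<noteq> {}"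
    proof (cases "?k = i")
      case True
      \<comment> \<open>Adding \<open>frag_of i\<close> makes the weight typical: the interchange
        yields \<open>frag_of (Suc i)\<close>, and the new correction turns it back into
        \<open>frag_of i\<close>.\<close>
      then show ?thesis using atypical atypical_not_dvd(1)[OF atypical]
        by (simp add: reflect_eq atypical_add_frag_of perm_act_add)
    next
      case False
      moreover have "?k \<noteq> Suc i" using kD(1)[OF that] red(3) by metis
      ultimately show ?thesis
        by (subst reflect_add[OF atypical_add_frag_of(1)]) auto
    qed
    ultimately show ?thesis by simp
  next
    case swap
    have B: "B r l = x ` A r l"
      unfolding A_def B_def by (rule positions_transpose[OF reduced_signature_typical[OF swap]])
    have "i \<notin> A r l \<or> Suc i \<notin> A r l"
      using swap(2) plus_positionsD unfolding A_def by fastforce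
    then have max: "Max (B r l) = x ?k" if "A r l \<noteq> {}"
      unfolding B using that finite_positions by (intro Max_transpose_image) (auto simp: A_def)
    \<comment> \<open>The weight stays typical: otherwise a \<open>Plus\<close> at one of the two
      positions would force one at the other, but one of the signs is \<open>Zero\<close>.\<close>
    have "atypical (l + frag_of ?k) \<longleftrightarrow> atypical l" if "A r l \<noteq> {}"
    proof (cases "?k = i \<or> ?k = Suc i")
      case True
      with kD(2)[OF that] swap dvd_sum_add_1[of l r] show ?thesis
        by (auto simp: atypical_add_frag_of)
    qed (simp add: atypical_add_frag_of)
    then show ?thesis using max by (auto simp: B card_image reflect_add)
  next
    case equal
    have B: "B r l = A r l"
      unfolding A_def B_def plus_positions_def reduced_signature_typical_eq[OF equal] ..
    have "reflect (l + frag_of ?k) = reflect l + frag_of ?k" if ne: "A r l \<noteq> {}"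
    proof -
      have "?k \<noteq> i"
      proof
        assume ki: "?k = i"
        with kD[OF ne] equal(2) have "Suc i \<in> A r l"
          using reduce_adjacent_Plus[OF finite_signature, of p v N r l i] in_range
          by (simp add: A_def plus_positions_def reduced_signature_def)
        then have "Suc i \<le> ?k" using finite_positions by (intro Max_ge) (auto simp: A_def)
        with ki show False by simp
      qed
      show ?thesis
      proof (cases "?k = Suc i")
        case True
        then have "int p dvd lk l i + lk l (Suc i) + 1"
          using kD(2)[OF ne] equal(2) by (intro Plus_Plus_dvd[of r]) auto
        \<comment> \<open>Now \<open>l + frag_of (Suc i)\<close> is atypical and loses the
          correction that \<open>reflect l\<close> has; this makes up for the interchange of
          \<open>frag_of (Suc i)\<close> with \<open>frag_of i\<close>.\<close>
        then show ?thesis using True equal(1)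
          by (simp add: reflect_eq atypical_add_frag_of perm_act_add)
      next
        case False
        with \<open>?k \<noteq> i\<close> show ?thesis by (subst reflect_add[OF atypical_add_frag_of(1)]) auto
      qed
    qed
    with B show ?thesis by simp
  qed
qed

text \<open>Mirror image of \<open>reflect_plus\<close> for \<open>eps_of\<close> and
  \<open>e_op\<close>: the leftmost \<open>Minus\<close> replaces the rightmost \<open>Plus\<close>,
  and \<open>i\<close> and \<open>Suc i\<close> trade roles.\<close>

lemma reflect_minus:
  defines "A \<equiv> \<lambda>r l. minus_positions p v N r l" and "B \<equiv> \<lambda>r l. minus_positions p w N r (reflect l)"
  shows "card (B r l) = card (A r l) \<and> (A r l \<noteq> {} \<longrightarrow>
    reflect (l - frag_of (Min (A r l))) = reflect l - frag_of (Min (B r l)))"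
proof -
  let ?S = "signature p v N r l" and ?k = "Min (A r l)"
  have k: "?k \<in> A r l" if "A r l \<noteq> {}"
    using that finite_positions unfolding A_def by (intro Min_in)
  note kD = minus_positionsD[OF k[unfolded A_def], folded A_def]
  consider (atypical) "atypical l"
    | (swap) "\<not> atypical l" "?S i = Zero \<or> ?S (Suc i) = Zero"
    | (equal) "\<not> atypical l" "?S i = ?S (Suc i)"
    using signature_typical_pair by blast
  then show ?thesis
  proof cases
    case atypical
    note red = reduced_signature_atypical[OF atypical, of r]
    have "B r l = A r l" unfolding A_def B_def minus_positions_def red(1) ..
    moreover have "reflect (l - frag_of ?k) = reflect l - frag_of ?k" if "A r l \<noteq> {}"
    proof (cases "?k = Suc i")
      case True
      then show ?thesis using atypical atypical_not_dvd(2)[OF atypical]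
        by (simp add: reflect_eq atypical_diff_frag_of perm_act_diff)
    next
      case False
      moreover have "?k \<noteq> i" using kD(1)[OF that] red(2) by metis
      ultimately show ?thesis
        by (subst reflect_diff[OF atypical_diff_frag_of(1)]) auto
    qed
    ultimately show ?thesis by simp
  next
    case swap
    have B: "B r l = x ` A r l"
      unfolding A_def B_def by (rule positions_transpose[OF reduced_signature_typical[OF swap]])
    have "i \<notin> A r l \<or> Suc i \<notin> A r l"
      using swap(2) minus_positionsD unfolding A_def by fastforce
    then have min: "Min (B r l) = x ?k" if "A r l \<noteq> {}"
      unfolding B using that finite_positions by (intro Min_transpose_image) (auto simp: A_def)
    have "atypical (l - frag_of ?k) \<longleftrightarrow> atypical l" if "A r l \<noteq> {}"
    proof (cases "?k = i \<or> ?k = Suc i")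
      case True
      with kD(2)[OF that] swap dvd_sum_diff_1[of l r] show ?thesis
        by (auto simp: atypical_diff_frag_of)
    qed (simp add: atypical_diff_frag_of)
    then show ?thesis using min by (auto simp: B card_image reflect_diff)
  next
    case equal
    have B: "B r l = A r l"
      unfolding A_def B_def minus_positions_def reduced_signature_typical_eq[OF equal] ..
    have "reflect (l - frag_of ?k) = reflect l - frag_of ?k" if ne: "A r l \<noteq> {}"
    proof -
      have "?k \<noteq> Suc i"
      proof
        assume ki: "?k = Suc i"
        with kD[OF ne] equal(2) have "i \<in> A r l"
          using reduce_adjacent_Minus[OF finite_signature, of p v N r l i] in_range
          by (simp add: A_def minus_positions_def reduced_signature_def)
        then have "?k \<le> i" using finite_positions by (intro Min_le) (auto simp: A_def)
        with ki show False by simp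
      qed
      show ?thesis
      proof (cases "?k = i")
        case True
        then have "int p dvd lk l i + lk l (Suc i) - 1"
          using kD(2)[OF ne] equal(2) by (intro Minus_Minus_dvd[of r]) auto
        then show ?thesis using True equal(1)
          by (simp add: reflect_eq atypical_diff_frag_of perm_act_diff)
      next
        case False
        with \<open>?k \<noteq> Suc i\<close> show ?thesis by (subst reflect_diff[OF atypical_diff_frag_of(1)]) auto
      qed
    qed
    with B show ?thesis by simp
  qed
qed

lemma crystal_iso_reflect:
  "crystal_iso (crystal_of_parity p N v) (crystal_of_parity p N w) reflect"
proof -
  \<comment> \<open>Finite sets of equal cardinality are empty together, so the operators yield
    \<open>None\<close> at the same elements.\<close>
  have empty: "plus_positions p w N r (reflect l) = {} \<longleftrightarrow> plus_positions p v N r l = {}"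
    "minus_positions p w N r (reflect l) = {} \<longleftrightarrow> minus_positions p v N r l = {}" for r l
    using reflect_plus[of r l] reflect_minus[of r l] finite_positions
    by (metis card_eq_0_iff)+
  show ?thesis
    unfolding crystal_iso_def
    using reflect_bij wt_reflect reflect_plus reflect_minus empty
    by (simp add: crystal_of_parity_def)
qed

end

theorem corollary6p2:
  fixes p m n i :: nat and v :: "nat \<Rightarrow> bit"
  assumes "p = 0 \<or> prime p"
    and "card {j \<in> {1..m + n}. v j = 0} = m"
    and "card {j \<in> {1..m + n}. v j = 1} = n"
    and "1 \<le> i" and "i \<le> m + n - 1"
    and "v i + v (i + 1) = 1"
  shows "crystal_iso
    (crystal_of_parity p (m + n) v)
    (crystal_of_parity p (m + n) (v \<circ> transpose i (i + 1)))
    (odd_reflection p (m + n) v i)"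
proof -
  have "odd_pair p (m + n) i v"
  proof
    show "p \<noteq> 1" using assms(1) by auto
    show "v i \<noteq> v (Suc i)" using assms(6) by auto
  qed (use assms in auto)
  then show ?thesis using odd_pair.crystal_iso_reflect by fastforce
qed

end
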